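(* Let $T_8$ be the infinite regular octagonal grid. Then $\lambda'_{1,2}(T_8)\geq 28$.
   Context: The infinite regular octagonal grid $T_8$ is the graph with vertex set $\mathbb{Z}^2$ in which two distinct vertices $(x,y)$ and $(x',y')$ are adjacent if and only if $\max(|x-x'|,|y-y'|)=1$ (so every vertex has degree 8, with horizontal, vertical and the two kinds of diagonal edges). For two edges $e_1,e_2$ of a graph $G$, the distance $d'(e_1,e_2)=k'$ if at least $k'-1$ edges of $G$ are needed to connect $e_1$ and $e_2$. Thus, for distinct edges, $d'(e_1,e_2)=1$ means that they share an endpoint, and $d'(e_1,e_2)=2$ means that they share no endpoint but some edge of $G$ joins an endpoint of $e_1$ to an endpoint of $e_2$. For non-negative integers $h,k$, an $L(h,k)$-edge labeling of $G$ is a function $f':E(G)\to\{0,1,\dots,n\}$ such that for all $e_1,e_2\in E(G)$, $|f'(e_1)-f'(e_2)|\geq h$ when $d'(e_1,e_2)=1$ and $|f'(e_1)-f'(e_2)|\geq k$ when $d'(e_1,e_2)=2$. The span $\lambda'_{h,k}(G)$ is the minimum $n$ such that $G$ admits an $L(h,k)$-edge labeling with values in $\{0,1,\dots,n\}$. *)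

theory Defs
  imports Main "HOL-Library.Extended_Nat"
begin

text \<open>Simple undirected graphs; an edge is the two-element set of its endpoints.\<close>

record 'a ugraph =
  verts :: "'a set"
  edges :: "'a set set"

definition simple_graph :: "'a ugraph \<Rightarrow> bool" where
  "simple_graph G \<longleftrightarrow> (\<forall>e\<in>edges G. e \<subseteq> verts G \<and> card e = 2)"

definition adj :: "'a ugraph \<Rightarrow> ('a \<times> 'a) set" where
  "adj G = {(u, v). {u, v} \<in> edges G}"

text \<open>
  For distinct edges, one plus the least number of edges on a walk joining an endpoint of the
  first edge to an endpoint of the second, which is \<^term>\<open>\<infinity>\<close> if there is no such walk.
  An edge has distance 0 from itself, so that the labeling conditions below only constrain
  pairs of distinct edges.
\<close>

definition edge_dist :: "'a ugraph \<Rightarrow> 'a set \<Rightarrow> 'a set \<Rightarrow> enat" where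
  "edge_dist G e1 e2 =
     (if e1 = e2 then 0
      else eSuc (INF n \<in> {n. \<exists>u\<in>e1. \<exists>v\<in>e2. (u, v) \<in> adj G ^^ n}. enat n))"

definition L_edge_labeling ::
  "nat \<Rightarrow> nat \<Rightarrow> 'a ugraph \<Rightarrow> nat \<Rightarrow> ('a set \<Rightarrow> nat) \<Rightarrow> bool" where
  "L_edge_labeling h k G n f \<longleftrightarrow>
     f ` edges G \<subseteq> {0..n} \<and>
     (\<forall>e1\<in>edges G. \<forall>e2\<in>edges G.
        (edge_dist G e1 e2 = 1 \<longrightarrow> \<bar>int (f e1) - int (f e2)\<bar> \<ge> int h) \<and>
        (edge_dist G e1 e2 = 2 \<longrightarrow> \<bar>int (f e1) - int (f e2)\<bar> \<ge> int k))"

text \<open>The minimum is attained whenever some labeling exists; otherwise the span is \<^term>\<open>\<infinity>\<close>.\<close>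

definition edge_span :: "nat \<Rightarrow> nat \<Rightarrow> 'a ugraph \<Rightarrow> enat" where
  "edge_span h k G = (INF n \<in> {n. \<exists>f. L_edge_labeling h k G n f}. enat n)"

definition T8 :: "(int \<times> int) ugraph" where
  "T8 = \<lparr>verts = UNIV,
         edges = {{(x, y), (x', y')} | x y x' y'. max \<bar>x - x'\<bar> \<bar>y - y'\<bar> = 1}\<rparr>"

lemma simple_graph_T8: "simple_graph T8"
proof -
  have "card {(x, y), (x', y')} = 2" if "max \<bar>x - x'\<bar> \<bar>y - y'\<bar> = 1" for x y x' y' :: int
  proof -
    have "(x, y) \<noteq> (x', y')"
      using that by auto
    then show ?thesis
      by simp
  qed
  then show ?thesis
    by (auto simp: simple_graph_def T8_def)
qed

lemma INF_enat_eq_iff: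
  "(INF n \<in> A. enat n) = enat m \<longleftrightarrow> m \<in> A \<and> (\<forall>n\<in>A. m \<le> n)"
proof
  assume *: "(INF n \<in> A. enat n) = enat m"
  then have "A \<noteq> {}"
    by (auto simp: top_enat_def)
  then have "(INF n \<in> A. enat n) \<in> enat ` A"
    by (metis ex_in_conv image_is_empty wellorder_InfI)
  with * have "m \<in> A"
    by auto
  moreover have "m \<le> n" if "n \<in> A" for n
    using INF_lower[OF that, of enat] * by simp
  ultimately show "m \<in> A \<and> (\<forall>n\<in>A. m \<le> n)"
    by blast
next
  assume "m \<in> A \<and> (\<forall>n\<in>A. m \<le> n)"
  then show "(INF n \<in> A. enat n) = enat m"
    by (intro antisym INF_lower2[of m] INF_greatest) auto
qed

lemma edge_dist_eq_1_iff:
  "edge_dist G e1 e2 = 1 \<longleftrightarrow> e1 \<noteq> e2 \<and> e1 \<inter> e2 \<noteq> {}"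
proof -
  have "eSuc i = 1 \<longleftrightarrow> i = enat 0" for i
    by (metis eSuc_inject one_eSuc zero_enat_def)
  then show ?thesis
    by (auto simp: edge_dist_def INF_enat_eq_iff)
qed

lemma edge_dist_eq_2_iff:
  "edge_dist G e1 e2 = 2 \<longleftrightarrow>
     e1 \<noteq> e2 \<and> e1 \<inter> e2 = {} \<and> (\<exists>u\<in>e1. \<exists>v\<in>e2. {u, v} \<in> edges G)"
proof -
  have "eSuc (enat 1) = 2"
    by (simp add: eSuc_enat numeral_eq_enat)
  then have 2: "eSuc i = 2 \<longleftrightarrow> i = enat 1" for i
    by (metis eSuc_inject)
  have "(\<forall>n\<in>A. 1 \<le> n) \<longleftrightarrow> 0 \<notin> A" for A :: "nat set"
    by (metis less_one not_le zero_neq_one)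
  then show ?thesis
    unfolding edge_dist_def by (simp add: 2 INF_enat_eq_iff adj_def del: One_nat_def) auto
qed

lemma edge_span_eq_enat_iff:
  "edge_span h k G = enat m \<longleftrightarrow>
     (\<exists>f. L_edge_labeling h k G m f) \<and> (\<forall>n f. L_edge_labeling h k G n f \<longrightarrow> m \<le> n)"
  by (auto simp: edge_span_def INF_enat_eq_iff)

end

theory Submission imports Defs
begin

text \<open>
  Any two edges meeting a common unit square are at distance at most 2, so the 26 edges meeting a
  unit square carry distinct labels, and of 28 available labels at most two are unused at the
  square. On the other hand, let \<open>e\<close> be an edge with label \<open>c + 1\<close>. Edges with label \<open>c\<close> within
  distance 2 of \<open>e\<close> must share an endpoint with \<open>e\<close>, and there is at most one of them, since \<open>e\<close>
  would join any two. It misses an endpoint of \<open>e\<close>, and no edge avoiding a vertex meets all four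
  unit squares around that vertex, so the label \<open>c\<close> is unused at some unit square meeting \<open>e\<close>.
  This assigns to the edges with nonzero label distinct pairs of a square and an unused label.
  There are about four edges per vertex, at most one in four of them labeled 0, but only two such
  pairs per square, which is a contradiction in a large enough box.
\<close>

definition block :: "int \<times> int \<Rightarrow> (int \<times> int) set" where
  "block q = {fst q, fst q + 1} \<times> {snd q, snd q + 1}"

definition edges_at :: "int \<times> int \<Rightarrow> (int \<times> int) set set" where
  "edges_at q = {e \<in> edges T8. e \<inter> block q \<noteq> {}}"

text \<open>The range is fixed at 0..27, independent of the bound \<open>n\<close> of the labeling,
  so one count covers every \<open>n \<le> 27\<close>.\<close>

definition unused_labels :: "((int \<times> int) set \<Rightarrow> nat) \<Rightarrow> int \<times> int \<Rightarrow> nat set" where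
  "unused_labels f q = {0..27} - f ` edges_at q"

section \<open>Edges meeting a common unit square\<close>

lemma doubleton_in_edges_T8_iff:
  "{u, v} \<in> edges T8 \<longleftrightarrow> max \<bar>fst u - fst v\<bar> \<bar>snd u - snd v\<bar> = 1"
  by (cases u; cases v) (auto simp: T8_def doubleton_eq_iff abs_minus_commute)

lemma edges_T8E:
  assumes "e \<in> edges T8"
  obtains u v where "e = {u, v}" "\<bar>fst u - fst v\<bar> \<le> 1" "\<bar>snd u - snd v\<bar> \<le> 1"
proof -
  obtain x y x' y' where *: "e = {(x, y), (x', y')}" "max \<bar>x - x'\<bar> \<bar>y - y'\<bar> = 1"
    using assms unfolding T8_def by auto
  have "\<bar>x - x'\<bar> \<le> 1" "\<bar>y - y'\<bar> \<le> 1"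
    unfolding *(2)[symmetric] by (rule max.cobounded1, rule max.cobounded2)
  then show thesis
    using that[of "(x, y)" "(x', y')"] *(1) by simp
qed

lemma block_clique:
  assumes "u \<in> block q" "v \<in> block q" "u \<noteq> v"
  shows "{u, v} \<in> edges T8"
  using assms by (cases u; cases v) (auto simp: block_def doubleton_in_edges_T8_iff)

lemma labels_ne_if_adjacent:
  assumes "L_edge_labeling 1 2 T8 n f" "e1 \<in> edges T8" "e2 \<in> edges T8"
    and "e1 \<noteq> e2" "e1 \<inter> e2 \<noteq> {}"
  shows "f e1 \<noteq> f e2"
  using assms edge_dist_eq_1_iff[of T8 e1 e2] unfolding L_edge_labeling_def by fastforce

lemma labels_diff_ge_2_if_joined:
  assumes "L_edge_labeling 1 2 T8 n f" "e1 \<in> edges T8" "e2 \<in> edges T8"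
    and "e1 \<inter> e2 = {}" "u \<in> e1" "v \<in> e2" "{u, v} \<in> edges T8"
  shows "\<bar>int (f e1) - int (f e2)\<bar> \<ge> 2"
proof -
  have "edge_dist T8 e1 e2 = 2"
    using assms by (auto simp: edge_dist_eq_2_iff)
  then have "\<bar>int (f e1) - int (f e2)\<bar> \<ge> int 2"
    using assms(1-3) unfolding L_edge_labeling_def by blast
  then show ?thesis
    by simp
qed

text \<open>The diagonals make a unit square a complete graph, so disjoint edges meeting it are at
  distance exactly 2.\<close>

lemma labels_diff_ge_2_if_common_block:
  assumes "L_edge_labeling 1 2 T8 n f" "e1 \<in> edges_at q" "e2 \<in> edges_at q" "e1 \<inter> e2 = {}"
  shows "\<bar>int (f e1) - int (f e2)\<bar> \<ge> 2"
proof -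
  obtain u v where "u \<in> e1" "u \<in> block q" "v \<in> e2" "v \<in> block q"
    using assms by (auto simp: edges_at_def)
  moreover from this have "u \<noteq> v"
    using assms by auto
  ultimately show ?thesis
    using assms labels_diff_ge_2_if_joined block_clique by (simp add: edges_at_def)
qed

lemma inj_on_labels_edges_at:
  assumes "L_edge_labeling 1 2 T8 n f"
  shows "inj_on f (edges_at q)"
proof (rule inj_onI, rule ccontr)
  fix e1 e2
  assume *: "e1 \<in> edges_at q" "e2 \<in> edges_at q" "f e1 = f e2" "e1 \<noteq> e2"
  then have "e1 \<inter> e2 = {}"
    using labels_ne_if_adjacent[OF assms, of e1 e2] by (auto simp: edges_at_def)
  then show False
    using labels_diff_ge_2_if_common_block[OF assms *(1,2)] *(3) by simp
qed

lemma ex_block_avoiding_edge: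
  assumes "e \<in> edges T8" "v \<notin> e"
  shows "\<exists>q. v \<in> block q \<and> e \<inter> block q = {}"
proof -
  obtain a b where e: "e = {a, b}" and ab: "\<bar>fst a - fst b\<bar> \<le> 1" "\<bar>snd a - snd b\<bar> \<le> 1"
    using assms(1) by (rule edges_T8E)
  obtain x y a1 a2 b1 b2 where coords: "v = (x, y)" "a = (a1, a2)" "b = (b1, b2)"
    by (metis surj_pair)
  have ne: "\<not> (a1 = x \<and> a2 = y)" "\<not> (b1 = x \<and> b2 = y)"
    using assms(2) by (auto simp: e coords)
  txt \<open>In each coordinate, both endpoints lie weakly on one side of \<open>v\<close>. The square on the
    opposite side in both coordinates can contain an endpoint only if that endpoint is \<open>v\<close>.\<close>
  have side: "\<exists>s\<in>{z - 1, z}. \<forall>p\<in>{c, d}. p \<in> {s, s + 1} \<longrightarrow> p = z"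
    if "\<bar>c - d\<bar> \<le> 1" for c d z :: int
  proof (cases "c \<le> z \<and> d \<le> z")
    case True
    then show ?thesis
      by (intro bexI[of _ z]) auto
  next
    case False
    with that have "z \<le> c" "z \<le> d"
      by linarith+
    then show ?thesis
      by (intro bexI[of _ "z - 1"]) auto
  qed
  have le1: "\<bar>a1 - b1\<bar> \<le> 1" and le2: "\<bar>a2 - b2\<bar> \<le> 1"
    using ab by (simp_all add: coords)
  obtain s where s: "s \<in> {x - 1, x}" "\<forall>p\<in>{a1, b1}. p \<in> {s, s + 1} \<longrightarrow> p = x"
    using side[of a1 b1 x] le1 by blast
  obtain t where t: "t \<in> {y - 1, y}" "\<forall>p\<in>{a2, b2}. p \<in> {t, t + 1} \<longrightarrow> p = y"
    using side[of a2 b2 y] le2 by blast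
  have "v \<in> block (s, t)"
    using s(1) t(1) by (auto simp: coords block_def)
  moreover have "a \<notin> block (s, t)" "b \<notin> block (s, t)"
    using s(2) t(2) ne by (auto simp: coords block_def)
  ultimately show ?thesis
    by (auto simp: e)
qed

lemma ex_block_unused_pred:
  assumes L: "L_edge_labeling 1 2 T8 n f" and "e \<in> edges T8" "f e = Suc c"
  shows "\<exists>q. e \<in> edges_at q \<and> c \<notin> f ` edges_at q"
proof (rule ccontr)
  assume *: "\<not> ?thesis"
  have all: "\<exists>e'\<in>edges_at q. f e' = c" if "v \<in> e" "v \<in> block q" for v q
  proof -
    have "e \<in> edges_at q"
      using that assms(2) by (auto simp: edges_at_def)
    then show ?thesis
      using * by blast
  qed
  \<comment> \<open>Labels \<open>c\<close> and \<open>c + 1\<close> differ by 1 only, too little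
    for disjoint edges at a common square.\<close>
  have meets: "e \<inter> e' \<noteq> {}" if "v \<in> e" "v \<in> block q" "e' \<in> edges_at q" "f e' = c" for v q e'
    using labels_diff_ge_2_if_common_block[OF L, of e q e'] that assms by (force simp: edges_at_def)
  have in_edges: "e' \<in> edges T8" if "e' \<in> edges_at q" for e' q
    using that by (simp add: edges_at_def)
  obtain u w where e: "e = {u, w}"
    using assms(2) by (rule edges_T8E)
  obtain e' where e': "e' \<in> edges_at u" "f e' = c"
    using all[of u u] by (auto simp: e block_def)
  have "e' \<in> edges T8" "e \<inter> e' \<noteq> {}"
    using e' in_edges meets[of u u e'] by (auto simp: e block_def)
  \<comment> \<open>Different edges labeled \<open>c\<close> are disjoint, so they meet
    \<open>e\<close> in different endpoints. Then \<open>e\<close> itself joins them, which would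
    require a gap of 2 between equal labels.\<close>
  have unique: "e'' = e'" if "e'' \<in> edges T8" "f e'' = c" "e \<inter> e'' \<noteq> {}" for e''
  proof (rule ccontr)
    assume "e'' \<noteq> e'"
    then have "e'' \<inter> e' = {}"
      using labels_ne_if_adjacent[OF L, of e'' e'] that \<open>e' \<in> edges T8\<close> e'(2) by auto
    moreover from this have "\<exists>a\<in>e''. \<exists>b\<in>e'. {a, b} = e"
      using that(3) \<open>e \<inter> e' \<noteq> {}\<close> by (auto simp: e insert_commute)
    ultimately show False
      using labels_diff_ge_2_if_joined[OF L, of e'' e'] that \<open>e' \<in> edges T8\<close> e'(2) assms(2)
      by fastforce
  qed
  have "\<not> e \<subseteq> e'"
  proof
    assume "e \<subseteq> e'"
    moreover have "card e = 2" "card e' = 2"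
      using simple_graph_T8 assms(2) \<open>e' \<in> edges T8\<close> by (auto simp: simple_graph_def)
    ultimately have "e = e'"
      by (metis card_subset_eq card.infinite zero_neq_numeral)
    then show False
      using e'(2) assms(3) by simp
  qed
  then obtain v where v: "v \<in> e" "v \<notin> e'"
    by blast
  then obtain q where q: "v \<in> block q" "e' \<inter> block q = {}"
    using ex_block_avoiding_edge \<open>e' \<in> edges T8\<close> by blast
  then obtain e'' where e'': "e'' \<in> edges_at q" "f e'' = c"
    using all v by blast
  then have "e'' = e'"
    using unique meets[OF v(1) q(1)] in_edges by blast
  then show False
    using e''(1) q(2) by (simp add: edges_at_def)
qed

section \<open>Counting edges by starting point and direction\<close>

text \<open>Every edge is \<open>seg (p, d)\<close> for exactly one vertex \<open>p\<close> and one \<open>d \<in> dirs\<close>.\<close>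

definition dirs :: "(int \<times> int) set" where
  "dirs = {(1, 0), (0, 1), (1, 1), (1, -1)}"

fun seg :: "(int \<times> int) \<times> (int \<times> int) \<Rightarrow> (int \<times> int) set" where
  "seg ((x, y), (i, j)) = {(x, y), (x + i, y + j)}"

lemma seg_in_edges: "d \<in> dirs \<Longrightarrow> seg (p, d) \<in> edges T8"
  by (cases p) (auto simp: dirs_def doubleton_in_edges_T8_iff)

lemma inj_on_seg: "inj_on seg (UNIV \<times> dirs)"
proof (rule inj_onI)
  fix s s'
  assume *: "s \<in> UNIV \<times> dirs" "s' \<in> UNIV \<times> dirs" "seg s = seg s'"
  obtain x y i j x' y' i' j' where s: "s = ((x, y), (i, j))" "s' = ((x', y'), (i', j'))"
    by (metis surj_pair)
  \<comment> \<open>The endpoints agree either in order or swapped. A swap reverses the direction,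
    and \<open>dirs\<close> contains no two opposite vectors.\<close>
  have "x = x' \<and> y = y' \<and> i = i' \<and> j = j' \<or> i = - i' \<and> j = - j'"
    using *(3) by (auto simp: s doubleton_eq_iff)
  moreover have "\<not> (i = - i' \<and> j = - j')"
    using *(1,2) by (auto simp: s dirs_def)
  ultimately show "s = s'"
    by (simp add: s)
qed

lemma card_edges_at_ge:
  assumes "finite (edges_at q)"
  shows "26 \<le> card (edges_at q)"
proof -
  \<comment> \<open>Starting points are relative to \<open>q\<close>. There are 6 horizontal, 6
    vertical and 7 edges of each diagonal kind: in the two unions the first set has the start in the
    square, the second the end, and they overlap only in a diagonal of the square. In total this is
    4 * 8 - 6 = 26.\<close>
  define K :: "((int \<times> int) \<times> (int \<times> int)) set" where
    "K = ({-1, 0, 1} \<times> {0, 1}) \<times> {(1, 0)} \<union> ({0, 1} \<times> {-1, 0, 1}) \<times> {(0, 1)} \<union>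
         ({0, 1} \<times> {0, 1} \<union> {-1, 0} \<times> {-1, 0}) \<times> {(1, 1)} \<union>
         ({0, 1} \<times> {0, 1} \<union> {-1, 0} \<times> {1, 2}) \<times> {(1, -1)}"
  define t where "t = (\<lambda>((i, j), d :: int \<times> int). ((fst q + i, snd q + j), d))"
  have "card K = 26"
    unfolding K_def by code_simp
  have K_dirs: "\<forall>(p, d)\<in>K. d \<in> dirs"
    unfolding K_def dirs_def by code_simp
  have K_block: "\<forall>((i, j), (k, l))\<in>K.
      i \<in> {0, 1} \<and> j \<in> {0, 1} \<or> i + k \<in> {0, 1} \<and> j + l \<in> {0, 1}"
    unfolding K_def by code_simp
  have "inj_on t UNIV"
    by (auto simp: t_def inj_on_def)
  moreover have "t ` K \<subseteq> UNIV \<times> dirs"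
    using K_dirs by (auto simp: t_def)
  ultimately have "inj_on (seg \<circ> t) K"
    using comp_inj_on[OF inj_on_subset inj_on_subset[OF inj_on_seg]] by blast
  moreover have "(seg \<circ> t) ` K \<subseteq> edges_at q"
  proof (rule image_subsetI)
    fix s
    assume "s \<in> K"
    obtain i j k l where s: "s = ((i, j), (k, l))"
      by (metis surj_pair)
    have "(k, l) \<in> dirs"
      using K_dirs \<open>s \<in> K\<close> by (auto simp: s)
    then have "(seg \<circ> t) s \<in> edges T8"
      using seg_in_edges[of "(k, l)" "(fst q + i, snd q + j)"] by (simp add: s t_def)
    moreover have "i \<in> {0, 1} \<and> j \<in> {0, 1} \<or> i + k \<in> {0, 1} \<and> j + l \<in> {0, 1}"
      using K_block \<open>s \<in> K\<close> by (auto simp: s)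
    then have "(seg \<circ> t) s \<inter> block q \<noteq> {}"
      by (auto simp: s t_def block_def add.assoc)
    ultimately show "(seg \<circ> t) s \<in> edges_at q"
      by (simp add: edges_at_def)
  qed
  ultimately show ?thesis
    using card_mono[OF assms] card_image \<open>card K = 26\<close> by metis
qed

lemma card_unused_labels_le:
  assumes L: "L_edge_labeling 1 2 T8 n f" and "n \<le> 27"
  shows "card (unused_labels f q) \<le> 2"
proof -
  have sub: "f ` edges_at q \<subseteq> {0..27}"
    using assms by (fastforce simp: L_edge_labeling_def edges_at_def)
  have inj: "inj_on f (edges_at q)"
    using L by (rule inj_on_labels_edges_at)
  \<comment> \<open>Finiteness is read off from the labeling, which injects these edges into 28
    labels.\<close>
  have "finite (edges_at q)"
    using sub inj finite_subset by (metis finite_atLeastAtMost finite_image_iff)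
  then have "26 \<le> card (f ` edges_at q)"
    using card_edges_at_ge inj by (simp add: card_image)
  then show ?thesis
    using sub by (simp add: unused_labels_def card_Diff_subset finite_subset)
qed

theorem theorem3: "edge_span 1 2 T8 \<ge> 28"
proof -
  have False if L: "L_edge_labeling 1 2 T8 n f" and "n \<le> 27" for n f
  proof -
    \<comment> \<open>Side 12 is the least for which this count works: at least 3 * 144 = 432 edges
      have nonzero label, against 2 * 14 * 15 = 420 pairs.\<close>
    define B :: "(int \<times> int) set" where "B = {1..12} \<times> {1..12}"
    define Z where "Z = {s \<in> B \<times> dirs. f (seg s) = 0}"
    \<comment> \<open>Edges starting in \<open>B\<close> have endpoints in {1..13} \<times> {0..13},
      the direction (1, -1) reaching one row below. Lower left corners of squares meeting them
      extend one further left and down.\<close>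
    define P where "P = (SIGMA q : {0..13} \<times> {-1..13}. unused_labels f q)"
    have le27: "f e \<le> 27" if "e \<in> edges T8" for e
      using L that \<open>n \<le> 27\<close> by (fastforce simp: L_edge_labeling_def)
    have seg: "seg s \<in> edges T8" if "s \<in> B \<times> dirs" for s
      using that seg_in_edges by auto
    have seg_inj: "s = s'" if "s \<in> B \<times> dirs" "s' \<in> B \<times> dirs" "seg s = seg s'" for s s'
      using that by (intro inj_onD[OF inj_on_seg]) auto
    have "finite B" "card B = 144"
      by (simp_all add: B_def)
    have "finite dirs" "card dirs = 4"
      by (simp_all add: dirs_def)
    \<comment> \<open>Edges with a common starting point are adjacent, so at most one of them is
      labeled 0.\<close>
    have "inj_on fst Z"
    proof (rule inj_onI)
      fix s s'
      assume *: "s \<in> Z" "s' \<in> Z" "fst s = fst s'"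
      then have "seg s \<inter> seg s' \<noteq> {}"
        by (cases s; cases s') auto
      then have "seg s = seg s'"
        using labels_ne_if_adjacent[OF L, of "seg s" "seg s'"] * seg by (auto simp: Z_def)
      then show "s = s'"
        using * seg_inj by (simp add: Z_def)
    qed
    then have "card Z \<le> card B"
      by (rule card_inj_on_le) (auto simp: Z_def \<open>finite B\<close>)
    obtain h where h: "seg s \<in> edges_at (h s)" "f (seg s) - 1 \<notin> f ` edges_at (h s)"
      if "s \<in> B \<times> dirs - Z" for s
    proof -
      have "\<exists>q. seg s \<in> edges_at q \<and> f (seg s) - 1 \<notin> f ` edges_at q"
        if "s \<in> B \<times> dirs - Z" for s
        using ex_block_unused_pred[OF L seg, of s "f (seg s) - 1"] that by (auto simp: Z_def)
      then show thesis
        using that by metis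
    qed
    have "inj_on (\<lambda>s. (h s, f (seg s) - 1)) (B \<times> dirs - Z)"
    proof (rule inj_onI)
      fix s s'
      assume *: "s \<in> B \<times> dirs - Z" "s' \<in> B \<times> dirs - Z"
        "(h s, f (seg s) - 1) = (h s', f (seg s') - 1)"
      \<comment> \<open>Outside \<open>Z\<close> labels are positive, so the truncated subtraction
        of 1 loses nothing.\<close>
      then have "f (seg s) = f (seg s')"
        by (auto simp: Z_def)
      then have "seg s = seg s'"
        using inj_onD[OF inj_on_labels_edges_at[OF L, of "h s"]] h(1)[OF *(1)] h(1)[OF *(2)] *(3)
        by simp
      then show "s = s'"
        using * seg_inj by simp
    qed
    moreover have "(\<lambda>s. (h s, f (seg s) - 1)) ` (B \<times> dirs - Z) \<subseteq> P"
    proof (rule image_subsetI)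
      fix s
      assume s: "s \<in> B \<times> dirs - Z"
      then have "h s \<in> {0..13} \<times> {-1..13}"
        using h(1)[OF s] by (cases "h s") (auto simp: edges_at_def block_def B_def dirs_def)
      moreover have "f (seg s) \<le> 27"
        using s by (intro le27 seg) simp
      ultimately show "(h s, f (seg s) - 1) \<in> P"
        using h(2)[OF s] by (auto simp: P_def unused_labels_def)
    qed
    moreover have "finite P"
      unfolding P_def by (intro finite_SigmaI) (auto simp: unused_labels_def)
    ultimately have "card (B \<times> dirs - Z) \<le> card P"
      by (rule card_inj_on_le)
    also have "\<dots> = (\<Sum>q\<in>{0..13} \<times> {-1..13}. card (unused_labels f q))"
      unfolding P_def by (intro card_SigmaI) (auto simp: unused_labels_def)
    also have "\<dots> \<le> (\<Sum>q\<in>{0..13::int} \<times> {-1..13::int}. 2)"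
      by (intro sum_mono card_unused_labels_le[OF L \<open>n \<le> 27\<close>])
    also have "\<dots> = 420"
      by simp
    finally have "card (B \<times> dirs - Z) \<le> 420" .
    moreover have "card (B \<times> dirs - Z) = 4 * 144 - card Z"
      using \<open>finite B\<close> \<open>finite dirs\<close> \<open>card B = 144\<close> \<open>card dirs = 4\<close>
      by (subst card_Diff_subset) (auto simp: Z_def card_cartesian_product)
    ultimately show False
      using \<open>card Z \<le> card B\<close> \<open>card B = 144\<close> by simp
  qed
  then have "28 \<le> n" if "L_edge_labeling 1 2 T8 n f" for n f
    using that by fastforce
  then show ?thesis
    unfolding edge_span_def by (intro INF_greatest) (auto simp: numeral_eq_enat)
qed

end
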